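(* For every integer $n\ge 3$, let $M(n)$ be the maximum, over all sets $S\subset\mathbb{R}^2$ of $n$ points with no three collinear and over all triangulations $T$ of $S$, of the number of convex polygons contained in $T$. Then $M(n)=O(1.5029^n)$.
   Context: A (geometric) triangulation of a finite set $S\subset\mathbb{R}^2$ is a plane straight-line graph (edges are straight segments that do not cross) with vertex set $S$ such that all bounded faces are triangles that jointly tile the convex hull of $S$. A convex polygon in a plane straight-line graph $G$ is a cycle of $G$ (as a subgraph) whose interior, i.e. the bounded region it encloses, is convex. The number of convex polygons contained in $G$ is the number of such cycles. *)

theory Defs
  imports "HOL-Analysis.Analysis" "HOL-Library.Landau_Symbols"
begin

type_synonym point = "real ^ 2"

text \<open>
  A straight-line graph is given by its vertex set and its edge set; an edge is the
  two-element set \<open>e\<close> of its endpoints and is drawn as the segment \<open>convex hull e\<close>.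
\<close>

definition drawing :: "point set set \<Rightarrow> point set" where
  "drawing E = (\<Union>e\<in>E. convex hull e)"

definition plane_straight_line_graph :: "point set \<Rightarrow> point set set \<Rightarrow> bool" where
  "plane_straight_line_graph S E \<longleftrightarrow>
     finite S \<and>
     (\<forall>e\<in>E. e \<subseteq> S \<and> card e = 2 \<and> convex hull e \<inter> S = e) \<and>
     (\<forall>e\<in>E. \<forall>f\<in>E. e \<noteq> f \<longrightarrow> convex hull e \<inter> convex hull f = e \<inter> f)"

definition bounded_faces :: "point set \<Rightarrow> point set set \<Rightarrow> point set set" where
  "bounded_faces S E = {F \<in> components (- (S \<union> drawing E)). bounded F}"

text \<open>Faces are open sets, so the tiles are their closures.\<close>

definition geometric_triangulation :: "point set \<Rightarrow> point set set \<Rightarrow> bool" where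
  "geometric_triangulation S E \<longleftrightarrow>
     plane_straight_line_graph S E \<and>
     (\<forall>F\<in>bounded_faces S E. \<exists>a b c. {a, b} \<in> E \<and> {b, c} \<in> E \<and> {c, a} \<in> E \<and>
        F = interior (convex hull {a, b, c})) \<and>
     (\<Union>F\<in>bounded_faces S E. closure F) = convex hull S"

text \<open>
  A cycle is identified with its edge set, so that the choice of starting vertex and
  direction of traversal does not matter when cycles are counted.
\<close>

definition is_cycle_in :: "point set set \<Rightarrow> point set set \<Rightarrow> bool" where
  "is_cycle_in C E \<longleftrightarrow>
     C \<subseteq> E \<and>
     (\<exists>vs. distinct vs \<and> 3 \<le> length vs \<and>
        C = {{vs ! i, vs ! (Suc i mod length vs)} | i. i < length vs})"

definition convex_polygons :: "point set set \<Rightarrow> point set set set" where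
  "convex_polygons E = {C. is_cycle_in C E \<and> convex (inside (drawing C))}"

definition no_three_collinear :: "point set \<Rightarrow> bool" where
  "no_three_collinear S \<longleftrightarrow> (\<forall>A\<subseteq>S. card A = 3 \<longrightarrow> \<not> collinear A)"

text \<open>
  On type \<^typ>\<open>nat\<close>, \<^const>\<open>Sup\<close> is the maximum of every nonempty finite set.
  For fixed \<open>n\<close> the set below is finite: a graph on \<open>n\<close> vertices has at most
  \<open>n choose 2\<close> edges, and a cycle is a set of edges.
\<close>

definition max_convex_polygons :: "nat \<Rightarrow> nat" where
  "max_convex_polygons n =
     Sup {card (convex_polygons E) | S E.
       finite S \<and> card S = n \<and> no_three_collinear S \<and> geometric_triangulation S E}"

end

theory Submission
  imports Defs
begin

text \<open>
  Fix a direction in which the points of \<open>S\<close> have distinct coordinates, and count the convex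
  polygons with leftmost vertex \<open>p\<close> and rightmost vertex \<open>q\<close>; there are at most \<open>n\<^sup>2\<close> such
  pairs. A polygon with convex hull \<open>K\<close> is determined by \<open>S \<inter> K\<close>, hence by the sets
  of points of \<open>S \<inter> K\<close> above and below the line \<open>p q\<close>. Consider the upper sets, ordered by
  coordinate and with \<open>p\<close> and \<open>q\<close> added. If \<open>i < j < k < l\<close>, where \<open>i, k\<close> are consecutive in the
  set of \<open>K\<close> and \<open>j, l\<close> are consecutive in that of \<open>L\<close>, then \<open>j\<close> lies above \<open>K\<close> and \<open>k\<close> lies
  above \<open>L\<close>, so the upper boundaries of \<open>K\<close> and \<open>L\<close> cross between \<open>j\<close> and \<open>k\<close>. By planarity they
  share a vertex there, which contradicts that \<open>i, k\<close> are consecutive. So the gaps of the family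
  are pairwise noncrossing. In such a family, all sets except \<open>{p, q}\<close> share an inner point, namely
  the end of the longest gap at \<open>p\<close> other than \<open>(p, q)\<close>. Splitting there bounds the size by a
  function \<open>g\<close> with \<open>g i * g j + 1 \<le> g (i + j)\<close>.
\<close>

subsection \<open>Families with noncrossing gaps\<close>

definition gap :: "'a::linorder set \<Rightarrow> 'a \<Rightarrow> 'a \<Rightarrow> bool" where
  "gap A i k \<longleftrightarrow> i \<in> A \<and> k \<in> A \<and> i < k \<and> A \<inter> {i<..<k} = {}"

text \<open>\<open>A\<close> and \<open>B\<close> range over ordered pairs, so the single pattern
  \<open>i < j < k < l\<close> rules out crossings from either side; nested gaps and gaps sharing an
  end are allowed.\<close>

definition noncrossing :: "'a::linorder set set \<Rightarrow> bool" where
  "noncrossing \<A> \<longleftrightarrow>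
     (\<forall>A\<in>\<A>. \<forall>B\<in>\<A>. \<forall>i j k l. gap A i k \<and> gap B j l \<longrightarrow> \<not> (i < j \<and> j < k \<and> k < l))"

lemma gap_straddling:
  fixes A :: "'a::linorder set"
  assumes "finite A" "a \<in> A" "a < u" "b \<in> A" "u < b" "u \<notin> A"
  obtains i k where "gap A i k" "i < u" "u < k" "a \<le> i" "k \<le> b"
proof
  let ?i = "Max (A \<inter> {..<u})" and ?k = "Min (A \<inter> {u<..})"
  have ne: "A \<inter> {..<u} \<noteq> {}" "A \<inter> {u<..} \<noteq> {}" and fin: "finite (A \<inter> {..<u})" "finite (A \<inter> {u<..})"
    using assms by auto
  have i: "?i \<in> A \<inter> {..<u}" "\<And>x. x \<in> A \<Longrightarrow> x < u \<Longrightarrow> x \<le> ?i"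
    using Max_in[OF fin(1) ne(1)] Max_ge[OF fin(1)] by auto
  have k: "?k \<in> A \<inter> {u<..}" "\<And>x. x \<in> A \<Longrightarrow> u < x \<Longrightarrow> ?k \<le> x"
    using Min_in[OF fin(2) ne(2)] Min_le[OF fin(2)] by auto
  show "?i < u" "u < ?k" using i k by auto
  show "a \<le> ?i" "?k \<le> b" using i k assms by auto
  have "x \<notin> A" if "?i < x" "x < ?k" for x
    using i(2)[of x] k(2)[of x] that assms(6) by (metis neqE not_le)
  then show "gap A ?i ?k"
    using i(1) k(1) by (auto simp: gap_def)
qed

text \<open>\<open>u\<close> is the largest first step from \<open>p\<close> that falls short of
  \<open>q\<close>. A set missing \<open>u\<close> has a gap straddling \<open>u\<close>. If that
  gap starts at \<open>p\<close>, it is a longer first step, or it reaches \<open>q\<close> and the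
  set is \<open>{p, q}\<close>; if it starts later, it crosses the gap from \<open>p\<close> to
  \<open>u\<close>.\<close>

lemma noncrossing_common_element:
  fixes P :: "'a::linorder set"
  assumes P: "finite P" "P \<subseteq> {p..q}" "p < q"
    and F: "\<And>A. A \<in> \<A> \<Longrightarrow> p \<in> A \<and> q \<in> A \<and> A \<subseteq> P"
    and nc: "noncrossing \<A>"
    and ne: "A0 \<in> \<A>" "A0 \<noteq> {p, q}"
  obtains u where "p < u" "u < q" "u \<in> P" "\<And>A. A \<in> \<A> \<Longrightarrow> A \<noteq> {p, q} \<Longrightarrow> u \<in> A"
proof -
  define U where "U = {u. u < q \<and> (\<exists>A\<in>\<A>. gap A p u)}"
  have fin: "finite A" if "A \<in> \<A>" for A
    using F[OF that] P(1) finite_subset by blast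
  have inner: "\<exists>x\<in>A. p < x \<and> x < q" if A: "A \<in> \<A>" "A \<noteq> {p, q}" for A
  proof -
    obtain x where "x \<in> A" "x \<noteq> p" "x \<noteq> q"
      using A F[OF A(1)] by auto
    moreover have "p \<le> x" "x \<le> q" using F[OF A(1)] P(2) \<open>x \<in> A\<close> by auto
    ultimately show ?thesis by force
  qed
  have "U \<subseteq> P" using F by (auto simp: U_def gap_def)
  then have finU: "finite U" using P(1) finite_subset by blast
  have "U \<noteq> {}"
  proof -
    let ?B = "A0 \<inter> {p<..}"
    have B: "finite ?B" "?B \<noteq> {}" using fin ne F P(3) by auto
    have m: "Min ?B \<in> ?B" using B by (rule Min_in)
    have le: "\<And>x. x \<in> A0 \<Longrightarrow> p < x \<Longrightarrow> Min ?B \<le> x" using B by simp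
    have "gap A0 p (Min ?B)"
      using m le F[OF ne(1)] by (force simp: gap_def dest!: leD)
    moreover have "Min ?B < q" using inner[OF ne] le by force
    ultimately show ?thesis using ne by (auto simp: U_def)
  qed
  define u where "u = Max U"
  have uU: "u \<in> U" using finU \<open>U \<noteq> {}\<close> by (simp add: u_def)
  have umax: "x \<le> u" if "x \<in> U" for x using that finU by (simp add: u_def)
  obtain B where B: "B \<in> \<A>" "gap B p u" and uq: "u < q" using uU by (auto simp: U_def)
  have pu: "p < u" using B by (simp add: gap_def)
  have "u \<in> A" if A: "A \<in> \<A>" "A \<noteq> {p, q}" for A
  proof (rule ccontr)
    assume "u \<notin> A"
    then obtain i k where ik: "gap A i k" "i < u" "u < k" "p \<le> i" "k \<le> q"
      using gap_straddling[of A p u q] F[OF A(1)] fin[OF A(1)] pu uq by metis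
    show False
    proof (cases "i = p")
      case True
      then have "k \<noteq> q" using ik(1) inner[OF A] by (force simp: gap_def)
      then have "k \<in> U" using ik A True by (auto simp: U_def)
      then show False using umax ik(3) by force
    next
      case False
      then have "p < i" using ik by auto
      then show False using nc B A ik unfolding noncrossing_def by blast
    qed
  qed
  then show thesis using that pu uq \<open>U \<subseteq> P\<close> uU by blast
qed

lemma gap_atMost:
  assumes "gap (A \<inter> {..u}) i k" shows "gap A i k"
  using assms by (force simp: gap_def)

lemma gap_atLeast:
  assumes "gap (A \<inter> {u..}) i k" shows "gap A i k"
  using assms by (force simp: gap_def)

text \<open>
  The smallest admissible \<open>g\<close> satisfies \<open>g (2 * n) = (g n)\<^sup>2 + 1\<close> for powers of two \<open>n\<close>,
  giving \<open>1, 2, 5, 26, 677, \<dots>\<close>, so its growth rate is about \<open>677 powr (1/16) = 1.50284\<dots>\<close>.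
\<close>

lemma card_noncrossing_le:
  fixes P :: "'a::linorder set" and g :: "nat \<Rightarrow> real"
  assumes g1: "\<And>n. 1 \<le> n \<Longrightarrow> 1 \<le> g n"
    and g_step: "\<And>i j. 1 \<le> i \<Longrightarrow> 1 \<le> j \<Longrightarrow> g i * g j + 1 \<le> g (i + j)"
    and "finite P" "p \<in> P" "q \<in> P" "p < q" "P \<subseteq> {p..q}"
    and "\<And>A. A \<in> \<A> \<Longrightarrow> p \<in> A \<and> q \<in> A \<and> A \<subseteq> P"
    and "noncrossing \<A>"
  shows "real (card \<A>) \<le> g (card P - 1)"
  using assms(3-)
proof (induction "card P" arbitrary: P p q \<A> rule: less_induct)
  case less
  note F = less.prems(6)
  have finF: "finite \<A>"
    using F less.prems(1) by (auto intro!: finite_subset[of \<A> "Pow P"])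
  have cP: "card P \<ge> 2"
  proof -
    have "card {p, q} \<le> card P" using less.prems by (intro card_mono) auto
    then show ?thesis using less.prems(4) by simp
  qed
  show ?case
  proof (cases "\<A> \<subseteq> {{p, q}}")
    case True
    then have "card \<A> \<le> 1" using card_mono[of "{{p,q}}" \<A>] by simp
    then have "real (card \<A>) \<le> 1" by simp
    then show ?thesis using g1[of "card P - 1"] cP by linarith
  next
    case False
    then obtain A0 where "A0 \<in> \<A>" "A0 \<noteq> {p, q}" by blast
    then obtain u where u: "p < u" "u < q" "u \<in> P"
      and all: "\<And>A. A \<in> \<A> \<Longrightarrow> A \<noteq> {p, q} \<Longrightarrow> u \<in> A"
      using noncrossing_common_element[OF less.prems(1,5,4) F less.prems(7)] by metis
    \<comment> \<open>Only \<open>{p, q}\<close> can avoid \<open>u\<close>; removing it accounts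
      for the \<open>+ 1\<close> in \<open>g_step\<close>.\<close>
    define \<B> where "\<B> = \<A> - {{p, q}}"
    define L where "L = (\<lambda>A. A \<inter> {..u}) ` \<B>"
    define R where "R = (\<lambda>A. A \<inter> {u..}) ` \<B>"
    have \<B>: "A \<in> \<A>" "u \<in> A" if "A \<in> \<B>" for A using that all by (auto simp: \<B>_def)
    have finLR: "finite L" "finite R" using finF by (auto simp: L_def R_def \<B>_def)
    have union: "(P \<inter> {..u}) \<union> (P \<inter> {u..}) = P" "(P \<inter> {..u}) \<inter> (P \<inter> {u..}) = {u}"
      using u by auto
    \<comment> \<open>Since \<open>u\<close> belongs to both halves, \<open>card P - 1\<close>, the
      number of elementary intervals, is what adds up under the split.\<close>
    have cards: "card (P \<inter> {..u}) + card (P \<inter> {u..}) = card P + 1"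
      using card_Un_Int[of "P \<inter> {..u}" "P \<inter> {u..}"] less.prems(1) union by simp
    have c1: "card (P \<inter> {..u}) \<ge> 2"
    proof -
      have "card {p, u} \<le> card (P \<inter> {..u})" using less.prems u by (intro card_mono) auto
      then show ?thesis using u by simp
    qed
    have c2: "card (P \<inter> {u..}) \<ge> 2"
    proof -
      have "card {u, q} \<le> card (P \<inter> {u..})" using less.prems u by (intro card_mono) auto
      then show ?thesis using u by simp
    qed
    have gL: "real (card L) \<le> g (card (P \<inter> {..u}) - 1)"
    proof (rule less.hyps)
      show "card (P \<inter> {..u}) < card P" using cards c2 by linarith
      show "noncrossing L"
        using less.prems(7) \<B>(1) unfolding noncrossing_def L_def by (blast dest: gap_atMost)
      show "p \<in> A \<and> u \<in> A \<and> A \<subseteq> P \<inter> {..u}" if "A \<in> L" for A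
        using that F \<B> u by (fastforce simp: L_def)
    qed (use less.prems u in auto)
    have gR: "real (card R) \<le> g (card (P \<inter> {u..}) - 1)"
    proof (rule less.hyps)
      show "card (P \<inter> {u..}) < card P" using cards c1 by linarith
      show "noncrossing R"
        using less.prems(7) \<B>(1) unfolding noncrossing_def R_def by (blast dest: gap_atLeast)
      show "u \<in> A \<and> q \<in> A \<and> A \<subseteq> P \<inter> {u..}" if "A \<in> R" for A
        using that F \<B> u by (fastforce simp: R_def)
    qed (use less.prems u in auto)
    have "card \<B> \<le> card (L \<times> R)"
    proof (rule card_inj_on_le)
      show "inj_on (\<lambda>A. (A \<inter> {..u}, A \<inter> {u..})) \<B>"
      proof (rule inj_onI)
        fix A B assume "(A \<inter> {..u}, A \<inter> {u..}) = (B \<inter> {..u}, B \<inter> {u..})"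
        then have "A \<inter> {..u} \<union> A \<inter> {u..} = B \<inter> {..u} \<union> B \<inter> {u..}" by simp
        moreover have "X \<inter> {..u} \<union> X \<inter> {u..} = X" for X by auto
        ultimately show "A = B" by simp
      qed
    qed (use finLR in \<open>auto simp: L_def R_def\<close>)
    then have "real (card \<B>) \<le> real (card L) * real (card R)"
      by (simp add: card_cartesian_product flip: of_nat_mult)
    also have "\<dots> \<le> g (card (P \<inter> {..u}) - 1) * g (card (P \<inter> {u..}) - 1)"
      using gL gR by (intro mult_mono) auto
    also have "\<dots> + 1 \<le> g (card P - 1)"
    proof -
      have "card (P \<inter> {..u}) - 1 + (card (P \<inter> {u..}) - 1) = card P - 1"
        using cards c1 c2 by linarith
      then show ?thesis
        using g_step[of "card (P \<inter> {..u}) - 1" "card (P \<inter> {u..}) - 1"] c1 c2 by auto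
    qed
    finally have "real (card \<B>) + 1 \<le> g (card P - 1)" by simp
    moreover have "card \<A> \<le> card \<B> + 1"
    proof -
      have "card \<A> \<le> card (insert {p, q} \<B>)"
        using finF by (intro card_mono) (auto simp: \<B>_def)
      also have "\<dots> \<le> card \<B> + 1" using card_insert_le_m1
        by (metis Suc_eq_plus1 card_insert_if finF finite_Diff \<B>_def le_Suc_eq order_refl)
      finally show ?thesis .
    qed
    ultimately show ?thesis by linarith
  qed
qed

text \<open>
  The tail is supermultiplicative with room for the \<open>+ 1\<close> because \<open>2 * 0.516 > 1\<close>; the first
  values are the optimal ones, since this margin only suffices from \<open>n = 8\<close> onwards.
\<close>

definition path_bound :: "nat \<Rightarrow> real" where
  "path_bound n =
     (if n \<le> 7 then [1, 1, 2, 3, 5, 7, 11, 16] ! n else 1.50286 ^ n - 0.516 / 1.50286 ^ n)"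

text \<open>The tabulated values obey the closed form too, so it can replace both factors in the
  step estimate. The tight case is \<open>n = 4\<close>, where the value 5 limits the constant
  \<open>0.516\<close> from above.\<close>

lemma path_bound_le_diff:
  assumes "1 \<le> n"
  shows "path_bound n \<le> 1.50286 ^ n - 0.516 / 1.50286 ^ n"
proof (cases "n \<le> 7")
  case True
  then have "n \<in> {1,2,3,4,5,6,7}" using assms by auto
  then show ?thesis by (auto simp: path_bound_def power_divide field_simps)
qed (simp add: path_bound_def)

lemma path_bound_le: "1 \<le> n \<Longrightarrow> path_bound n \<le> 1.50286 ^ n"
  using path_bound_le_diff[of n] by (rule order_trans) auto

lemma path_bound_ge_1: "1 \<le> path_bound n"
proof (cases "n \<le> 7")
  case True
  then have "n \<in> {0,1,2,3,4,5,6,7}" by auto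
  then show ?thesis by (auto simp: path_bound_def)
next
  case False
  let ?c = "1.50286 :: real"
  have "?c ^ 2 \<le> ?c ^ n" using False by (intro power_increasing) auto
  then have c: "2 \<le> ?c ^ n" by (simp add: power2_eq_square)
  then have "0.516 / ?c ^ n \<le> 0.516 / 2" by (intro divide_left_mono) auto
  then show ?thesis using c False by (simp add: path_bound_def)
qed

lemma path_bound_step:
  assumes "1 \<le> i" "1 \<le> j"
  shows "path_bound i * path_bound j + 1 \<le> path_bound (i + j)"
proof (cases "i + j \<le> 7")
  case True
  then have "i \<in> {1,2,3,4,5,6}" "j \<in> {1,2,3,4,5,6}" using assms by auto
  then show ?thesis using True by (elim insertE emptyE) (simp_all add: path_bound_def)
next
  case False
  define K :: real where "K = 0.516"
  define a b :: real where "a = 1.50286 ^ i" and "b = 1.50286 ^ j"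
  have ab: "a > 0" "b > 0" by (auto simp: a_def b_def)
  have "(1.50286 :: real) ^ 8 \<le> 1.50286 ^ (i + j)"
    using False by (intro power_increasing) auto
  moreover have "26 \<le> (1.50286 :: real) ^ 8" by (simp add: power_divide)
  ultimately have "26 \<le> a * b" by (simp add: power_add a_def b_def)
  have "path_bound i * path_bound j \<le> (a - K / a) * (b - K / b)"
    using path_bound_le_diff[OF assms(1)] path_bound_le_diff[OF assms(2)]
      path_bound_ge_1[of i] path_bound_ge_1[of j]
    by (intro mult_mono) (auto simp: a_def b_def K_def)
  also have "\<dots> = a * b - K * (a / b + b / a) + K * K / (a * b)"
    using ab by (simp add: field_simps)
  \<comment> \<open>The sum of \<open>a / b\<close> and its reciprocal is at least 2, so the mixed
    terms gain \<open>2 * K\<close>, which exceeds 1.\<close>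
  also have "\<dots> \<le> a * b - K * 2 + K * K / (a * b)"
  proof -
    have "a / b + b / a = (a - b)\<^sup>2 / (a * b) + 2"
      using ab by (simp add: field_simps power2_eq_square)
    then have "2 \<le> a / b + b / a" using ab by simp
    then show ?thesis by (simp add: K_def)
  qed
  \<comment> \<open>This amounts to \<open>(K * K + K) / (a * b) \<le> 2 * K - 1\<close>. At
    \<open>a * b = 26\<close> it needs \<open>K\<close> slightly above \<open>0.515\<close>, while
    the table entry at 4 allows little more than \<open>0.516\<close>.\<close>
  also have "\<dots> \<le> a * b - K / (a * b) - 1"
  proof -
    have "(K * K + K) / (a * b) \<le> (K * K + K) / 26"
      using \<open>26 \<le> a * b\<close> by (intro divide_left_mono) (auto simp: K_def)
    also have "\<dots> \<le> 2 * K - 1" by (simp add: K_def)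
    finally show ?thesis by (simp add: add_divide_distrib)
  qed
  finally have "path_bound i * path_bound j + 1 \<le> a * b - K / (a * b)" by simp
  then show ?thesis using False by (simp add: path_bound_def power_add a_def b_def K_def)
qed

subsection \<open>Upper boundaries of convex bodies\<close>

text \<open>\<open>d\<close> is the horizontal coordinate and \<open>N\<close> the height, not
  necessarily orthogonal to it; the graph over \<open>t\<close> is the upper boundary of
  \<open>K\<close>. The supremum is meaningful only on nonempty fibres, so a fibre point is supplied
  or constructed before it is used.\<close>

definition top_height :: "'a::euclidean_space \<Rightarrow> 'a \<Rightarrow> 'a set \<Rightarrow> real \<Rightarrow> real" where
  "top_height d N K t = (SUP v\<in>{v \<in> K. d \<bullet> v = t}. N \<bullet> v)"

lemma top_height_attained:
  assumes "compact K" "v0 \<in> K" "d \<bullet> v0 = t"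
  obtains z where "z \<in> K" "d \<bullet> z = t" "N \<bullet> z = top_height d N K t"
    "\<And>v. v \<in> K \<Longrightarrow> d \<bullet> v = t \<Longrightarrow> N \<bullet> v \<le> N \<bullet> z"
proof -
  let ?F = "K \<inter> {v. d \<bullet> v = t}"
  have "compact ?F" using assms(1) closed_hyperplane by (rule compact_Int_closed)
  moreover have "?F \<noteq> {}" using assms by auto
  ultimately obtain z where z: "z \<in> ?F" "\<And>v. v \<in> ?F \<Longrightarrow> N \<bullet> v \<le> N \<bullet> z"
    using continuous_attains_sup[of ?F "\<lambda>v. N \<bullet> v"] continuous_on_inner[OF continuous_on_const continuous_on_id]
    by blast
  have "top_height d N K t = N \<bullet> z"
    unfolding top_height_def by (rule cSup_eq_maximum) (use z in auto)
  then show thesis using that[of z] z by auto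
qed

lemma top_height_ge:
  assumes "compact K" "v \<in> K"
  shows "N \<bullet> v \<le> top_height d N K (d \<bullet> v)"
  using top_height_attained[OF assms refl] assms by metis

text \<open>The witness lies on the segment from \<open>p\<close> to \<open>q\<close>, along which
  \<open>N\<close> is constant.\<close>

lemma fibre_point:
  assumes "convex K" "p \<in> K" "q \<in> K" "d \<bullet> p < d \<bullet> q" "t \<in> {d \<bullet> p..d \<bullet> q}"
    "N \<bullet> p = c" "N \<bullet> q = c"
  obtains v where "v \<in> K" "d \<bullet> v = t" "N \<bullet> v = c"
proof -
  define s where "s = (t - d \<bullet> p) / (d \<bullet> q - d \<bullet> p)"
  have s: "0 \<le> s" "s \<le> 1" using assms by (auto simp: s_def)
  let ?v = "(1 - s) *\<^sub>R p + s *\<^sub>R q"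
  have "?v \<in> K" using convexD_alt[OF assms(1-3) s] .
  moreover have "d \<bullet> ?v = d \<bullet> p + s * (d \<bullet> q - d \<bullet> p)"
    by (simp add: inner_add_right algebra_simps)
  then have "d \<bullet> ?v = t" using assms(4) by (simp add: s_def)
  moreover have "N \<bullet> ?v = c" using assms by (simp add: inner_add_right algebra_simps)
  ultimately show thesis by (rule that)
qed

text \<open>A convex combination of two highest points stays in \<open>K\<close>, hence below the
  top of its own fibre.\<close>

lemma concave_on_top_height:
  assumes K: "compact K" "convex K" and pq: "p \<in> K" "q \<in> K" "d \<bullet> p < d \<bullet> q"
  shows "concave_on {d \<bullet> p..d \<bullet> q} (top_height d N K)"
  unfolding concave_on_iff
proof (intro conjI ballI allI impI)
  fix x y and u v :: real
  assume x: "x \<in> {d \<bullet> p..d \<bullet> q}" and y: "y \<in> {d \<bullet> p..d \<bullet> q}"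
    and uv: "0 \<le> u" "0 \<le> v" "u + v = 1"
  have fib: "\<exists>z. z \<in> K \<and> d \<bullet> z = t \<and> N \<bullet> z = top_height d N K t" if t: "t \<in> {d \<bullet> p..d \<bullet> q}" for t
  proof -
    \<comment> \<open>Taking the zero functional for \<open>N\<close> makes the height conditions
      trivial and leaves just a point of the fibre.\<close>
    obtain v0 where "v0 \<in> K" "d \<bullet> v0 = t"
      using fibre_point[OF K(2) pq t, of 0] by (metis inner_zero_left)
    then show ?thesis using top_height_attained[OF K(1)] by metis
  qed
  obtain a b where a: "a \<in> K" "d \<bullet> a = x" "N \<bullet> a = top_height d N K x"
    and b: "b \<in> K" "d \<bullet> b = y" "N \<bullet> b = top_height d N K y"
    using fib[OF x] fib[OF y] by blast
  have "u *\<^sub>R a + v *\<^sub>R b \<in> K" using K(2) a b uv by (simp add: convexD)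
  from top_height_ge[OF K(1) this, of N d]
  show "u * top_height d N K x + v * top_height d N K y \<le> top_height d N K (u *\<^sub>R x + v *\<^sub>R y)"
    using a b by (simp add: inner_add_right)
qed auto

text \<open>From an interior point, a small move along \<open>e\<close> would stay in
  \<open>K\<close> and on the same fibre while increasing \<open>N\<close>.\<close>

lemma top_height_frontier:
  assumes "compact K" "z \<in> K" "N \<bullet> z = top_height d N K (d \<bullet> z)" "d \<bullet> e = 0" "0 < N \<bullet> e"
  shows "z \<in> frontier K"
proof -
  have "z \<notin> interior K"
  proof
    assume "z \<in> interior K"
    then obtain r where r: "0 < r" "cball z r \<subseteq> K" by (auto simp: mem_interior_cball)
    define w where "w = z + (r / norm e) *\<^sub>R e"
    have e: "norm e > 0" using assms(5) by auto
    have "w \<in> cball z r" using e r by (simp add: w_def dist_norm)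
    then have "N \<bullet> w \<le> top_height d N K (d \<bullet> w)" using r assms(1) by (intro top_height_ge) auto
    moreover have "d \<bullet> w = d \<bullet> z" using assms by (simp add: w_def inner_add_right)
    moreover have "N \<bullet> w > N \<bullet> z" using assms e r by (simp add: w_def inner_add_right)
    ultimately show False using assms by simp
  qed
  then show ?thesis using assms(1,2) by (simp add: frontier_def closure_closed compact_imp_closed)
qed

text \<open>If \<open>f\<close> exceeded the line at \<open>x\<close>, the chord from
  \<open>x\<close> to \<open>y\<close> would exceed it at \<open>t\<close>, and by concavity so
  would \<open>f\<close>.\<close>

lemma concave_on_le_affine:
  fixes f :: "real \<Rightarrow> real"
  assumes f: "concave_on I f" and I: "x \<in> I" "y \<in> I" and xy: "x \<le> t" "t < y"
    and t: "f t \<le> m * t + b" and y: "m * y + b \<le> f y"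
  shows "f x \<le> m * x + b"
proof -
  define s where "s = (t - x) / (y - x)"
  have s: "0 \<le> s" "s < 1" using xy by (auto simp: s_def)
  have ts: "t = (1 - s) * x + s * y"
  proof -
    have "s * (y - x) = t - x" using xy by (simp add: s_def)
    then show ?thesis by (simp add: algebra_simps)
  qed
  have "(1 - s) * f x + s * f y \<le> f t"
    using concave_onD[OF f, of s x y] I s ts by simp
  also have "\<dots> \<le> m * t + b" by (rule t)
  also have "\<dots> = (1 - s) * (m * x + b) + s * (m * y + b)"
    by (simp add: ts algebra_simps)
  also have "\<dots> \<le> (1 - s) * (m * x + b) + s * f y"
    using y s by (simp add: mult_left_mono)
  finally show ?thesis using s by simp
qed

lemma concave_on_greater:
  fixes f :: "real \<Rightarrow> real"
  assumes f: "concave_on I f" and I: "p \<in> I" "b \<in> I" and x: "p < x" "x \<le> b"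
    and "c \<le> f p" "c < f b"
  shows "c < f x"
proof -
  define s where "s = (x - p) / (b - p)"
  have s: "0 < s" "s \<le> 1" using x by (auto simp: s_def)
  have "s * (b - p) = x - p" using x by (simp add: s_def)
  then have xs: "x = (1 - s) * p + s * b" by (simp add: algebra_simps)
  have "c = (1 - s) * c + s * c" by (simp add: algebra_simps)
  also have "\<dots> < (1 - s) * f p + s * f b"
    using assms s by (intro add_le_less_mono mult_left_mono mult_strict_left_mono) auto
  also have "\<dots> \<le> f x" using concave_onD[OF f, of s p b] I s xs by simp
  finally show ?thesis .
qed

text \<open>The difference of the two top heights changes sign between \<open>j\<close> and
  \<open>k\<close>, so the intermediate value theorem applies. The last two conclusions serve to
  locate a vertex near the meeting point.\<close>

lemma upper_boundaries_meet:
  assumes K: "compact K" "convex K" and L: "compact L" "convex L"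
    and pq: "p \<in> K" "q \<in> K" "p \<in> L" "q \<in> L" "N \<bullet> p = c" "N \<bullet> q = c"
    and jk: "j \<in> L" "j \<notin> K" "k \<in> K" "k \<notin> L" "c < N \<bullet> j" "c < N \<bullet> k"
    and order: "d \<bullet> p < d \<bullet> j" "d \<bullet> j < d \<bullet> k" "d \<bullet> k < d \<bullet> q"
    and nondeg: "\<And>v. d \<bullet> v = 0 \<Longrightarrow> N \<bullet> v = 0 \<Longrightarrow> v = 0"
  obtains t where "d \<bullet> j < t" "t < d \<bullet> k" "top_height d N K t = top_height d N L t"
    "top_height d N K (d \<bullet> j) < top_height d N L (d \<bullet> j)"
    "\<And>x. d \<bullet> p < x \<Longrightarrow> x \<le> d \<bullet> k \<Longrightarrow> c < top_height d N K x"
proof -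
  have less: "d \<bullet> p < d \<bullet> q" using order by linarith
  \<comment> \<open>The fibre of \<open>M\<close> at \<open>v\<close> contains a point at height
    \<open>c\<close>. A point of \<open>M\<close> level with or above \<open>v\<close> would put
    \<open>v\<close> on a segment between two points of \<open>M\<close>.\<close>
  have above: "top_height d N M (d \<bullet> v) < N \<bullet> v"
    if M: "compact M" "convex M" "p \<in> M" "q \<in> M" and v: "v \<notin> M" "c < N \<bullet> v" "d \<bullet> v \<in> {d \<bullet> p..d \<bullet> q}" for M v
  proof (rule ccontr)
    assume "\<not> ?thesis"
    then have le: "N \<bullet> v \<le> top_height d N M (d \<bullet> v)" by simp
    obtain y where y: "y \<in> M" "d \<bullet> y = d \<bullet> v" "N \<bullet> y = c"
      using fibre_point[OF M(2-4) less v(3) pq(5,6)] by metis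
    obtain z where z: "z \<in> M" "d \<bullet> z = d \<bullet> v" "N \<bullet> z = top_height d N M (d \<bullet> v)"
      using top_height_attained[OF M(1) y(1,2)] by metis
    define s where "s = (N \<bullet> v - c) / (N \<bullet> z - c)"
    have pos: "0 < N \<bullet> z - c" using le z v by simp
    have s: "0 \<le> s" "s \<le> 1" using le z v pos by (auto simp: s_def)
    have *: "s * (N \<bullet> z - c) = N \<bullet> v - c" using pos by (simp add: s_def)
    let ?w = "(1 - s) *\<^sub>R y + s *\<^sub>R z"
    have "?w - v = 0"
    proof (rule nondeg)
      show "d \<bullet> (?w - v) = 0" using y z by (simp add: inner_simps algebra_simps)
      show "N \<bullet> (?w - v) = 0" using y * by (simp add: inner_simps algebra_simps)
    qed
    moreover have "?w \<in> M" using convexD_alt[OF M(2) y(1) z(1) s] .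
    ultimately show False using v by simp
  qed
  let ?f = "top_height d N K" and ?g = "top_height d N L"
  let ?I = "{d \<bullet> p..d \<bullet> q}"
  have conc: "concave_on ?I ?f" "concave_on ?I ?g"
    using K L pq less by (auto intro: concave_on_top_height)
  \<comment> \<open>A concave function may jump at the ends of a closed interval; \<open>j\<close>
    and \<open>k\<close> lie strictly inside.\<close>
  have "concave_on {d \<bullet> p<..<d \<bullet> q} ?f" "concave_on {d \<bullet> p<..<d \<bullet> q} ?g"
    using conc unfolding concave_on_def by (auto intro: convex_on_subset)
  then have "continuous_on {d \<bullet> p<..<d \<bullet> q} (\<lambda>x. - ?f x)"
    "continuous_on {d \<bullet> p<..<d \<bullet> q} (\<lambda>x. - ?g x)"
    unfolding concave_on_def by (auto intro: convex_on_continuous)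
  then have "continuous_on {d \<bullet> p<..<d \<bullet> q} (\<lambda>x. - ?f x - (- ?g x))" by (rule continuous_on_diff)
  then have cont: "continuous_on {d \<bullet> j..d \<bullet> k} (\<lambda>x. ?g x - ?f x)"
    by (rule continuous_on_subset[THEN continuous_on_eq]) (use order in auto)
  have at_j: "?f (d \<bullet> j) < ?g (d \<bullet> j)"
    using above[OF K pq(1,2) jk(2,5)] top_height_ge[OF L(1) jk(1), of N d] order by auto
  have at_k: "?g (d \<bullet> k) < ?f (d \<bullet> k)"
    using above[OF L pq(3,4) jk(4,6)] top_height_ge[OF K(1) jk(3), of N d] order by auto
  obtain t where t: "d \<bullet> j \<le> t" "t \<le> d \<bullet> k" "?g t - ?f t = 0"
    using IVT2'[of "\<lambda>x. ?g x - ?f x" "d \<bullet> k" 0 "d \<bullet> j"] cont at_j at_k order by auto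
  have pos: "c < ?f x" if "d \<bullet> p < x" "x \<le> d \<bullet> k" for x
  proof (rule concave_on_greater[OF conc(1) _ _ that])
    show "c < ?f (d \<bullet> k)" using top_height_ge[OF K(1) jk(3), of N d] jk by simp
    show "c \<le> ?f (d \<bullet> p)" using top_height_ge[OF K(1) pq(1), of N d] pq by simp
  qed (use order in auto)
  have "t \<noteq> d \<bullet> j" "t \<noteq> d \<bullet> k" using t(3) at_j at_k by auto
  then show thesis using that[of t] t at_j pos by auto
qed

subsection \<open>Convex polygons as boundaries of convex hulls\<close>

text \<open>Induction prepends one segment at a time. As \<open>x\<close> is not among the later
  vertices, the new segment meets the rest of the arc only in \<open>y\<close>.\<close>

lemma arc_through_vertices:
  fixes vs :: "'a::euclidean_space list"
  assumes "distinct vs" "2 \<le> length vs"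
    and "\<And>i j. Suc i < length vs \<Longrightarrow> Suc j < length vs \<Longrightarrow> i \<noteq> j \<Longrightarrow>
      convex hull {vs ! i, vs ! Suc i} \<inter> convex hull {vs ! j, vs ! Suc j}
        \<subseteq> {vs ! i, vs ! Suc i} \<inter> {vs ! j, vs ! Suc j}"
  shows "\<exists>g. arc g \<and> pathstart g = hd vs \<and> pathfinish g = last vs \<and>
     path_image g = (\<Union>i\<in>{i. Suc i < length vs}. convex hull {vs ! i, vs ! Suc i})"
  using assms
proof (induction vs)
  case Nil
  then show ?case by simp
next
  case (Cons x ws)
  then obtain y zs where ws: "ws = y # zs" by (cases ws) auto
  have set_eq: "{i. Suc i < length (x # ws)} = insert 0 (Suc ` {i. Suc i < length ws})"
    by (auto simp: ws image_iff) (metis Suc_less_eq not0_implies_Suc)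
  show ?case
  proof (cases zs)
    case Nil
    then show ?thesis
      using Cons.prems ws
      by (intro exI[of _ "linepath x y"]) (auto simp: segment_convex_hull)
  next
    case (Cons z rs)
    have "\<exists>g. arc g \<and> pathstart g = hd ws \<and> pathfinish g = last ws \<and>
       path_image g = (\<Union>i\<in>{i. Suc i < length ws}. convex hull {ws ! i, ws ! Suc i})"
    proof (rule Cons.IH)
      fix i j assume "Suc i < length ws" "Suc j < length ws" "i \<noteq> j"
      then show "convex hull {ws ! i, ws ! Suc i} \<inter> convex hull {ws ! j, ws ! Suc j}
        \<subseteq> {ws ! i, ws ! Suc i} \<inter> {ws ! j, ws ! Suc j}"
        using Cons.prems(3)[of "Suc i" "Suc j"] by simp
    qed (use Cons.prems Cons ws in auto)
    then obtain g where g: "arc g" "pathstart g = y" "pathfinish g = last ws"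
      "path_image g = (\<Union>i\<in>{i. Suc i < length ws}. convex hull {ws ! i, ws ! Suc i})"
      using ws by auto
    have "path_image (linepath x y) \<inter> path_image g \<subseteq> {y}"
    proof -
      have "convex hull {x, y} \<inter> convex hull {ws ! i, ws ! Suc i} \<subseteq> {y}"
        if "Suc i < length ws" for i
      proof -
        have "convex hull {x, y} \<inter> convex hull {ws ! i, ws ! Suc i}
              \<subseteq> {x, y} \<inter> {ws ! i, ws ! Suc i}"
          using Cons.prems(3)[of 0 "Suc i"] that ws by simp
        moreover have "x \<noteq> ws ! i" "x \<noteq> ws ! Suc i"
          using Cons.prems(1) that nth_mem[of i ws] nth_mem[of "Suc i" ws] by auto
        ultimately show ?thesis by auto
      qed
      then show ?thesis by (auto simp: g segment_convex_hull)
    qed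
    then have "arc (linepath x y +++ g)"
      using Cons.prems(1) ws g by (intro arc_join) auto
    moreover have "path_image (linepath x y +++ g) =
        (\<Union>i\<in>{i. Suc i < length (x # ws)}. convex hull {(x # ws) ! i, (x # ws) ! Suc i})"
      unfolding set_eq using g ws by (simp add: path_image_join segment_convex_hull)
    ultimately show ?thesis
      using g ws by (intro exI[of _ "linepath x y +++ g"]) auto
  qed
qed

text \<open>By Jordan-Brouwer there is a bounded complementary component, and its frontier is
  \<open>S\<close>. Connectedness, supplied by convexity in the application, identifies the whole
  inside with that component.\<close>

lemma homeomorphic_sphere_frontier_inside:
  fixes S :: "'a::euclidean_space set" and a :: 'a
  assumes hom: "S homeomorphic sphere a r" and r: "0 < r" and dim: "2 \<le> DIM('a)"
    and conn: "connected (inside S)"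
  shows "frontier (inside S) = S" "open (inside S)" "bounded (inside S)" "inside S \<noteq> {}"
proof -
  have comp: "compact S" 
    using homeomorphic_compactness[OF hom] compact_sphere by simp
  then have bo: "bounded S" "closed S" by (auto simp: compact_imp_bounded compact_imp_closed)
  have "\<not> connected (- S)" using Jordan_Brouwer_separation[OF hom r] .
  \<comment> \<open>In dimension at least 2 the complement of a bounded set has only one unbounded
    component, so a disconnected complement has a bounded one.\<close>
  then obtain T where T: "T \<in> components (- S)" "bounded T"
    using cobounded_has_bounded_component[of "- S"] bo dim by auto
  show o: "open (inside S)" by (simp add: bo open_inside)
  show b: "bounded (inside S)" using bo dim by (simp add: bounded_inside)
  have T_ne: "T \<noteq> {}" using T in_components_nonempty by blast
  have "T \<subseteq> inside S"
  proof
    fix x assume x: "x \<in> T"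
    then have "T = connected_component_set (- S) x"
      using T(1) by (metis components_iff connected_component_eq)
    then show "x \<in> inside S" using T x in_components_subset[OF T(1)] by (auto simp: inside_def)
  qed
  moreover have "inside S \<subseteq> T"
  proof (rule components_maximal[OF T(1) conn])
    show "inside S \<subseteq> - S" by (auto simp: inside_def)
    show "T \<inter> inside S \<noteq> {}" using T_ne \<open>T \<subseteq> inside S\<close> by auto
  qed
  ultimately have "inside S = T" by auto
  then show "frontier (inside S) = S" "inside S \<noteq> {}"
    using Jordan_Brouwer_frontier[OF hom T(1) dim] T_ne by auto
qed

section \<open>Cycles in a plane straight-line graph\<close>

context
  fixes S :: "point set" and E :: "point set set"
  assumes psl: "plane_straight_line_graph S E"
begin

lemma edge: "e \<in> E \<Longrightarrow> e \<subseteq> S" "e \<in> E \<Longrightarrow> card e = 2"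
  and edges_Int: "e \<in> E \<Longrightarrow> f \<in> E \<Longrightarrow> e \<noteq> f \<Longrightarrow> convex hull e \<inter> convex hull f = e \<inter> f"
  and finite_vertices: "finite S"
  using psl unfolding plane_straight_line_graph_def by blast+

text \<open>All edges but the last form an arc, and the last one closes it to a simple loop, hence a
  circle.\<close>

lemma drawing_cycle_homeomorphic:
  assumes "is_cycle_in C E"
  shows "drawing C homeomorphic sphere (0::point) 1"
proof -
  obtain vs where vs: "C \<subseteq> E" "distinct vs" "3 \<le> length vs"
      "C = {{vs ! i, vs ! (Suc i mod length vs)} | i. i < length vs}"
    using assms unfolding is_cycle_in_def by blast
  define n where "n = length vs"
  define e where "e i = {vs ! i, vs ! (Suc i mod n)}" for i
  have C: "C = e ` {..<n}" by (auto simp: vs(4) e_def n_def)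
  have n: "3 \<le> n" using vs by (simp add: n_def)
  have eE: "e i \<in> E" if "i < n" for i using vs(1) C that by auto
  \<comment> \<open>Equal edges at different positions would each be the successor of the other,
    which is impossible in a cycle of length at least 3.\<close>
  have einj: "i = j" if "i < n" "j < n" "e i = e j" for i j
  proof (rule ccontr)
    assume "i \<noteq> j"
    have nth: "vs ! a = vs ! b \<longleftrightarrow> a = b" if "a < n" "b < n" for a b
      using nth_eq_iff_index_eq[OF vs(2)] that by (simp add: n_def)
    have ij: "i = Suc j mod n" "j = Suc i mod n"
      using that \<open>i \<noteq> j\<close> n by (auto simp: e_def doubleton_eq_iff nth)
    have mod: "Suc k mod n = (if Suc k = n then 0 else Suc k)" if "k < n" for k
      using that by (simp add: mod_Suc)
    have "Suc j = n \<and> i = 0 \<or> i = Suc j"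
      using ij(1) mod[OF that(2)] by (cases "Suc j = n") simp_all
    moreover have "Suc i = n \<and> j = 0 \<or> j = Suc i"
      using ij(2) mod[OF that(1)] by (cases "Suc i = n") simp_all
    ultimately show False using n by arith
  qed
  have hull: "convex hull (e i) \<inter> convex hull (e j) = e i \<inter> e j"
    if "i < n" "j < n" "i \<noteq> j" for i j
    using edges_Int[OF eE eE] that einj by blast
  have e_Suc: "e i = {vs ! i, vs ! Suc i}" if "Suc i < n" for i using that by (simp add: e_def)
  have "\<exists>g. arc g \<and> pathstart g = hd vs \<and> pathfinish g = last vs \<and>
     path_image g = (\<Union>i\<in>{i. Suc i < length vs}. convex hull {vs ! i, vs ! Suc i})"
  proof (rule arc_through_vertices)
    fix i j assume ij: "Suc i < length vs" "Suc j < length vs" "i \<noteq> j"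
    then show "convex hull {vs ! i, vs ! Suc i} \<inter> convex hull {vs ! j, vs ! Suc j}
        \<subseteq> {vs ! i, vs ! Suc i} \<inter> {vs ! j, vs ! Suc j}"
      using hull[of i j] e_Suc[of i] e_Suc[of j] by (simp add: n_def)
  qed (use vs in auto)
  then obtain g where g: "arc g" "pathstart g = hd vs" "pathfinish g = last vs"
      "path_image g = (\<Union>i\<in>{i. Suc i < n}. convex hull {vs ! i, vs ! Suc i})"
    by (auto simp: n_def)
  have img: "path_image g = (\<Union>i<n - 1. convex hull (e i))"
    using n unfolding g(4) by (auto simp: e_Suc less_diff_conv)
  have last: "last vs = vs ! (n - 1)" "hd vs = vs ! 0"
    using last_conv_nth[of vs] hd_conv_nth[of vs] vs(3) by (fastforce simp: n_def)+
  have e_last: "e (n - 1) = {last vs, hd vs}" using n by (simp add: e_def last)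
  have neq: "last vs \<noteq> hd vs"
  proof -
    have "vs \<noteq> []" "length vs - 1 < length vs" using vs(3) by auto
    then show ?thesis
      using nth_eq_iff_index_eq[OF vs(2), of "n - 1" 0] n by (simp add: last n_def)
  qed
  have "simple_path (g +++ linepath (last vs) (hd vs))"
  proof (rule simple_path_join_loop)
    have "convex hull (e i) \<inter> convex hull {last vs, hd vs} \<subseteq> {last vs, hd vs}"
      if "i < n - 1" for i
      using hull[of i "n - 1"] that n unfolding e_last by auto
    then show "path_image g \<inter> path_image (linepath (last vs) (hd vs))
        \<subseteq> {pathstart g, pathstart (linepath (last vs) (hd vs))}"
      unfolding img using g(2) by (fastforce simp: segment_convex_hull)
  qed (use g neq in auto)
  then have "path_image (g +++ linepath (last vs) (hd vs)) homeomorphic sphere (0::complex) 1"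
    by (rule homeomorphic_simple_path_image_circle) (use g in auto)
  moreover have "path_image (g +++ linepath (last vs) (hd vs)) = drawing C"
  proof -
    have "{..<n} = insert (n - 1) {..<n - 1}" using n by auto
    then have "drawing C = (\<Union>i<n - 1. convex hull (e i)) \<union> convex hull (e (n - 1))"
      by (auto simp: drawing_def C)
    then show ?thesis
      unfolding e_last using g(1-3) by (simp add: path_image_join segment_convex_hull img)
  qed
  moreover have "sphere (0::complex) 1 homeomorphic sphere (0::point) 1"
    by (rule homeomorphic_spheres_gen) auto
  ultimately show ?thesis
    using homeomorphic_trans by fastforce
qed

text \<open>The closure of the inside is compact and convex, hence the hull of its frontier, which
  is the drawing. The drawing in turn lies in the hull of the vertices.\<close>

lemma frontier_convex_polygon:
  assumes "C \<in> convex_polygons E"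
  shows "frontier (convex hull (\<Union>C)) = drawing C"
proof -
  have cyc: "is_cycle_in C E" and conv: "convex (inside (drawing C))"
    using assms by (auto simp: convex_polygons_def)
  define I where "I = inside (drawing C)"
  have fr: "frontier I = drawing C" and I: "open I" "bounded I" "I \<noteq> {}" "convex I"
    using homeomorphic_sphere_frontier_inside[OF drawing_cycle_homeomorphic[OF cyc]]
      convex_connected[OF conv] conv by (auto simp: I_def)
  \<comment> \<open>For an open convex set, taking the closure adds no interior points, so the
    frontier is unchanged.\<close>
  have int: "interior (closure I) = I"
    using convex_interior_closure[OF I(4)] I(1) by (simp add: interior_open)
  then have frc: "frontier (closure I) = drawing C"
    using fr I(1) by (simp add: frontier_def interior_open)
  have "closure I = convex hull (frontier (closure I))"
    by (rule Krein_Milman_frontier)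
      (use I in \<open>auto simp: convex_closure compact_closure\<close>)
  then have hull: "closure I = convex hull (drawing C)" using frc by simp
  have "convex hull (drawing C) = convex hull (\<Union>C)"
  proof
    have "drawing C \<subseteq> convex hull (\<Union>C)"
      unfolding drawing_def by (intro UN_least hull_mono) auto
    then show "convex hull (drawing C) \<subseteq> convex hull (\<Union>C)"
      by (simp add: hull_minimal)
    have "\<Union>C \<subseteq> drawing C" unfolding drawing_def using hull_subset by fastforce
    then show "convex hull (\<Union>C) \<subseteq> convex hull (drawing C)" by (rule hull_mono)
  qed
  then show ?thesis using hull frc by simp
qed

text \<open>If an edge outside \<open>C\<close> were drawn inside \<open>drawing C\<close>, its
  midpoint would lie on another edge, and planarity would make the midpoint an endpoint.\<close>

lemma cycle_eq_drawing:
  assumes "C \<subseteq> E"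
  shows "C = {e \<in> E. convex hull e \<subseteq> drawing C}"
proof -
  have "e \<in> C" if e: "e \<in> E" "convex hull e \<subseteq> drawing C" for e
  proof (rule ccontr)
    assume "e \<notin> C"
    obtain a b where ab: "e = {a, b}" "a \<noteq> b" using edge(2)[OF e(1)] by (auto simp: card_2_iff)
    have m: "midpoint a b \<in> convex hull e" by (simp add: ab flip: segment_convex_hull)
    then obtain f where f: "f \<in> C" "midpoint a b \<in> convex hull f"
      using e(2) by (auto simp: drawing_def)
    then have "convex hull e \<inter> convex hull f = e \<inter> f"
      using edges_Int[of e f] e assms \<open>e \<notin> C\<close> by blast
    then have "midpoint a b \<in> {a, b}" using m f ab by blast
    then show False using ab(2) by (auto simp: midpoint_eq_endpoint)
  qed
  then show ?thesis using assms by (auto simp: drawing_def)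
qed

text \<open>The trace on \<open>S\<close> determines the hull, the hull its frontier, which is the
  drawing, and the drawing its edges.\<close>

lemma inj_on_vertices_in_hull:
  "inj_on (\<lambda>C. S \<inter> convex hull (\<Union>C)) (convex_polygons E)"
proof (rule inj_onI)
  fix C D
  assume C: "C \<in> convex_polygons E" and D: "D \<in> convex_polygons E"
    and eq: "S \<inter> convex hull (\<Union>C) = S \<inter> convex hull (\<Union>D)"
  have sub: "X \<subseteq> E" if "X \<in> convex_polygons E" for X
    using that by (auto simp: convex_polygons_def is_cycle_in_def)
  have "convex hull (\<Union>X) = convex hull (S \<inter> convex hull (\<Union>X))"
    if "X \<in> convex_polygons E" for X
  proof
    have "\<Union>X \<subseteq> S \<inter> convex hull (\<Union>X)" using sub[OF that] edge(1) hull_subset by fastforce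
    then show "convex hull (\<Union>X) \<subseteq> convex hull (S \<inter> convex hull (\<Union>X))" by (rule hull_mono)
  qed (simp add: hull_minimal)
  from this[OF C] this[OF D] have "convex hull (\<Union>C) = convex hull (\<Union>D)"
    unfolding eq by simp
  then have "drawing C = drawing D"
    using frontier_convex_polygon[OF C] frontier_convex_polygon[OF D] by simp
  then show "C = D" using cycle_eq_drawing[OF sub[OF C]] cycle_eq_drawing[OF sub[OF D]] by simp
qed

text \<open>The upper boundaries meet at a point \<open>z\<close> strictly between \<open>j\<close>
  and \<open>k\<close>. If \<open>z\<close> is no vertex, planarity puts it inside an edge common to
  both boundaries, and the left end \<open>r\<close> of that edge is the required vertex.\<close>

lemma common_vertex_between:
  assumes K: "compact K" "convex K" "frontier K = drawing C" "C \<subseteq> E"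
    and L: "compact L" "convex L" "frontier L = drawing D" "D \<subseteq> E"
    and pq: "p \<in> K" "q \<in> K" "p \<in> L" "q \<in> L" "N \<bullet> p = c" "N \<bullet> q = c"
    and jk: "j \<in> L" "j \<notin> K" "k \<in> K" "k \<notin> L" "c < N \<bullet> j" "c < N \<bullet> k"
    and order: "d \<bullet> p < d \<bullet> j" "d \<bullet> j < d \<bullet> k" "d \<bullet> k < d \<bullet> q"
    and nondeg: "\<And>v. d \<bullet> v = 0 \<Longrightarrow> N \<bullet> v = 0 \<Longrightarrow> v = 0"
    and up: "d \<bullet> up = 0" "0 < N \<bullet> up"
    and inj: "inj_on (\<lambda>v. d \<bullet> v) S"
  shows "\<exists>v\<in>S \<inter> K. c < N \<bullet> v \<and> d \<bullet> j < d \<bullet> v \<and> d \<bullet> v < d \<bullet> k"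
proof -
  let ?f = "top_height d N K" and ?g = "top_height d N L"
  let ?I = "{d \<bullet> p..d \<bullet> q}"
  have less: "d \<bullet> p < d \<bullet> q" using order by linarith
  obtain t where t: "d \<bullet> j < t" "t < d \<bullet> k" "?f t = ?g t"
    and at_j: "?f (d \<bullet> j) < ?g (d \<bullet> j)"
    and pos: "\<And>x. d \<bullet> p < x \<Longrightarrow> x \<le> d \<bullet> k \<Longrightarrow> c < ?f x"
    using upper_boundaries_meet[OF K(1,2) L(1,2) pq jk order nondeg] by metis
  have tI: "t \<in> ?I" using t order by auto
  obtain z where z: "z \<in> K" "d \<bullet> z = t" "N \<bullet> z = ?f t"
    using fibre_point[OF K(2) pq(1,2) less tI pq(5,6)] top_height_attained[OF K(1)] by metis
  obtain z' where z': "z' \<in> L" "d \<bullet> z' = t" "N \<bullet> z' = ?g t"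
    using fibre_point[OF L(2) pq(3,4) less tI pq(5,6)] top_height_attained[OF L(1)] by metis
  \<comment> \<open>Both top points have the same \<open>d\<close> and \<open>N\<close> coordinates,
    which determine a point.\<close>
  have "z - z' = 0" using nondeg[of "z - z'"] z z' t by (simp add: inner_diff_right)
  then have "z' = z" by simp
  have "z \<in> drawing C" "z \<in> drawing D"
    using top_height_frontier[OF K(1) z(1) _ up] top_height_frontier[OF L(1) z'(1) _ up]
      K(3) L(3) z z' \<open>z' = z\<close> by auto
  then obtain e e' where e: "e \<in> C" "z \<in> convex hull e" and e': "e' \<in> D" "z \<in> convex hull e'"
    by (auto simp: drawing_def)
  have hull: "convex hull x \<subseteq> K" if "x \<in> C" for x
    using K(1,3) that frontier_subset_closed[of K] compact_imp_closed by (auto simp: drawing_def)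
  have hull': "convex hull x \<subseteq> L" if "x \<in> D" for x
    using L(1,3) that frontier_subset_closed[of L] compact_imp_closed by (auto simp: drawing_def)
  show ?thesis
  proof (cases "z \<in> S")
    case True
    then show ?thesis using z pos[of t] t order by (intro bexI[of _ z]) auto
  next
    case False
    have "e = e'"
    proof (rule ccontr)
      assume "e \<noteq> e'"
      then have "z \<in> e \<inter> e'" using edges_Int[of e e'] e e' K(4) L(4) by blast
      then show False using False edge(1) e K(4) by blast
    qed
    have eE: "e \<in> E" using e K(4) by blast
    obtain r0 s0 where e0: "e = {r0, s0}" "r0 \<noteq> s0" using edge(2)[OF eE] by (auto simp: card_2_iff)
    have rsS: "r0 \<in> S" "s0 \<in> S" using edge(1)[OF eE] e0 by auto
    have "d \<bullet> r0 \<noteq> d \<bullet> s0" using inj_onD[OF inj _ rsS] e0(2) by blast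
    then obtain r s where rs: "e = {r, s}" "d \<bullet> r < d \<bullet> s" "r \<in> S" "s \<in> S"
      using e0 rsS by (metis insert_commute neqE)
    have "z \<in> closed_segment r s" using e(2) rs(1) by (simp add: segment_convex_hull)
    then obtain \<mu> where \<mu>: "z = (1 - \<mu>) *\<^sub>R r + \<mu> *\<^sub>R s" "0 \<le> \<mu>" "\<mu> \<le> 1"
      by (auto simp: in_segment)
    have "\<mu> \<noteq> 0" "\<mu> \<noteq> 1" using \<mu>(1) False rs by auto
    then have \<mu>': "0 < \<mu>" "\<mu> < 1" using \<mu> by auto
    have t_eq: "t = d \<bullet> r + \<mu> * (d \<bullet> s - d \<bullet> r)"
      using z(2) \<mu>(1) by (simp add: inner_add_right algebra_simps)
    have rK: "r \<in> K" "s \<in> K" "r \<in> L" "s \<in> L"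
      using hull[OF e(1)] hull'[OF e'(1)] \<open>e = e'\<close> rs(1) hull_subset[of e convex] by auto
    have rt: "d \<bullet> r < t" "t < d \<bullet> s"
    proof -
      show "d \<bullet> r < t" using t_eq \<mu>'(1) rs(2) by simp
      have "\<mu> * (d \<bullet> s - d \<bullet> r) < 1 * (d \<bullet> s - d \<bullet> r)"
        using \<mu>'(2) rs(2) by (intro mult_strict_right_mono) auto
      then show "t < d \<bullet> s" using t_eq by simp
    qed
    \<comment> \<open>The line through \<open>r\<close> and \<open>s\<close> in the coordinates
      given by \<open>d\<close> and \<open>N\<close>.\<close>
    define m where "m = (N \<bullet> s - N \<bullet> r) / (d \<bullet> s - d \<bullet> r)"
    define b where "b = N \<bullet> r - m * (d \<bullet> r)"
    have ms: "m * (d \<bullet> s - d \<bullet> r) = N \<bullet> s - N \<bullet> r" using rs(2) by (simp add: m_def)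
    have line: "m * (d \<bullet> r) + b = N \<bullet> r" "m * (d \<bullet> s) + b = N \<bullet> s"
      using ms by (auto simp: b_def algebra_simps)
    have "m * t + b = N \<bullet> r + \<mu> * (m * (d \<bullet> s - d \<bullet> r))"
      by (simp add: t_eq b_def algebra_simps)
    also have "\<dots> = N \<bullet> z" unfolding ms by (subst \<mu>(1)) (simp add: inner_add_right algebra_simps)
    finally have line_t: "m * t + b = ?f t" using z by simp
    have concave: "concave_on {d \<bullet> r..d \<bullet> s} ?f" "concave_on {d \<bullet> r..d \<bullet> s} ?g"
      using K L rK rs by (auto intro: concave_on_top_height)
    \<comment> \<open>Both top heights touch the line at \<open>t\<close> and reach at least the
      line at \<open>s\<close>, so concavity keeps them below it to the left of
      \<open>t\<close>.\<close>
    have below: "?f x \<le> m * x + b" "?g x \<le> m * x + b" if "d \<bullet> r \<le> x" "x \<le> t" for x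
    proof -
      show "?f x \<le> m * x + b"
        using concave_on_le_affine[OF concave(1), of x "d \<bullet> s" t m b] that rt line line_t
          top_height_ge[OF K(1) rK(2), of N d] by simp
      show "?g x \<le> m * x + b"
        using concave_on_le_affine[OF concave(2), of x "d \<bullet> s" t m b] that rt line line_t t(3)
          top_height_ge[OF L(1) rK(4), of N d] by simp
    qed
    \<comment> \<open>Otherwise the edge passes over or through the fibre of \<open>j\<close>: there
      \<open>L\<close> stays below its line, while \<open>K\<close> contains a point on it, against
      \<open>at_j\<close>.\<close>
    have "d \<bullet> j < d \<bullet> r"
    proof (rule ccontr)
      assume "\<not> ?thesis"
      then have jr: "d \<bullet> r \<le> d \<bullet> j" by simp
      then have "?g (d \<bullet> j) \<le> m * (d \<bullet> j) + b" using below t by simp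
      also have "\<dots> \<le> ?f (d \<bullet> j)"
      proof -
        define s' where "s' = (d \<bullet> j - d \<bullet> r) / (d \<bullet> s - d \<bullet> r)"
        have s': "0 \<le> s'" "s' \<le> 1" using jr rs(2) rt t by (auto simp: s'_def)
        have eq: "s' * (d \<bullet> s - d \<bullet> r) = d \<bullet> j - d \<bullet> r" using rs(2) by (simp add: s'_def)
        let ?y = "(1 - s') *\<^sub>R r + s' *\<^sub>R s"
        have "?y \<in> K" using convexD_alt[OF K(2) rK(1,2) s'] .
        moreover have dy: "d \<bullet> ?y = d \<bullet> j" using eq by (simp add: inner_add_right algebra_simps)
        moreover have "N \<bullet> ?y = m * (d \<bullet> ?y) + b"
        proof -
          have "N \<bullet> ?y = (1 - s') * (m * (d \<bullet> r) + b) + s' * (m * (d \<bullet> s) + b)"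
            unfolding line by (simp add: inner_add_right)
          also have "\<dots> = m * (d \<bullet> ?y) + b" by (simp add: inner_add_right algebra_simps)
          finally show ?thesis .
        qed
        ultimately show ?thesis using top_height_ge[OF K(1), of ?y N d] by simp
      qed
      finally show False using at_j by simp
    qed
    moreover have "c < N \<bullet> r"
      using pos[of "d \<bullet> r"] below(1)[of "d \<bullet> r"] line(1) rt t order calculation by simp
    ultimately show ?thesis using rK rs rt t by (intro bexI[of _ r]) auto
  qed
qed

end

subsection \<open>Counting convex polygons\<close>

lemma inner_2: "(v::point) \<bullet> w = v $ 1 * w $ 1 + v $ 2 * w $ 2"
  by (simp add: inner_vec_def sum_2)

text \<open>Among the directions \<open>(1, x)\<close>, each pair of distinct points excludes at
  most one value of \<open>x\<close>.\<close>

lemma exists_injective_direction: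
  fixes S :: "point set"
  assumes "finite S"
  shows "\<exists>d. inj_on (\<lambda>v. d \<bullet> v) S"
proof -
  define bad where
    "bad = (\<Union>v\<in>S. \<Union>w\<in>S. {x. v \<noteq> w \<and> (v $ 1 - w $ 1) + x * (v $ 2 - w $ 2) = 0})"
  have "finite {x. v \<noteq> w \<and> (v $ 1 - w $ 1) + x * (v $ 2 - w $ 2) = 0}" for v w :: point
  proof (cases "v $ 2 = w $ 2")
    case True
    then have "{x. v \<noteq> w \<and> (v $ 1 - w $ 1) + x * (v $ 2 - w $ 2) = 0} = {}"
      by (auto simp: vec_eq_iff forall_2)
    then show ?thesis by (metis finite.emptyI)
  next
    case False
    then have "{x. v \<noteq> w \<and> (v $ 1 - w $ 1) + x * (v $ 2 - w $ 2) = 0}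
        \<subseteq> {- (v $ 1 - w $ 1) / (v $ 2 - w $ 2)}"
      by (auto simp: field_simps)
    then show ?thesis using finite_subset by blast
  qed
  then have "finite bad" using assms by (simp add: bad_def)
  then obtain x where x: "x \<notin> bad" using ex_new_if_finite[OF infinite_UNIV_char_0] by blast
  have "inj_on (\<lambda>v. vector [1, x] \<bullet> v) S"
  proof (rule inj_onI)
    fix v w :: point assume "v \<in> S" "w \<in> S" "vector [1, x] \<bullet> v = vector [1, x] \<bullet> w"
    moreover from this(3) have "(v $ 1 - w $ 1) + x * (v $ 2 - w $ 2) = 0"
      by (simp add: inner_2 vector_2 algebra_simps)
    ultimately show "v = w" using x by (auto simp: bad_def)
  qed
  then show ?thesis by blast
qed

text \<open>The counterclockwise quarter turn. Pairing with it gives the determinant, whose sign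
  tells the side of a line.\<close>

definition perp :: "point \<Rightarrow> point" where
  "perp v = vector [- (v $ 2), v $ 1]"

lemma inner_perp: "perp v \<bullet> w = v $ 1 * w $ 2 - v $ 2 * w $ 1"
  by (simp add: perp_def inner_2 vector_2)

lemma inner_perp_perp: "perp v \<bullet> perp w = v \<bullet> w"
  by (simp add: perp_def inner_2 vector_2)

text \<open>A vanishing determinant makes \<open>v\<close> parallel to \<open>u\<close>, and
  \<open>d\<close> does not vanish on \<open>u\<close>. Thus \<open>d\<close> and
  \<open>perp u\<close> together are coordinates of the plane.\<close>

lemma inner_perp_nondegenerate:
  assumes "d \<bullet> u \<noteq> 0" "d \<bullet> v = 0" "perp u \<bullet> v = 0"
  shows "v = 0"
proof -
  have u: "u $ 1 * v $ 2 = u $ 2 * v $ 1" using assms(3) by (simp add: inner_perp)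
  have "(d \<bullet> u) * v $ 1 = d $ 1 * u $ 1 * v $ 1 + d $ 2 * (u $ 2 * v $ 1)"
    by (simp add: inner_2 algebra_simps)
  also have "\<dots> = u $ 1 * (d \<bullet> v)" unfolding u[symmetric] by (simp add: inner_2 algebra_simps)
  finally have "v $ 1 = 0" using assms by simp
  have "(d \<bullet> u) * v $ 2 = d $ 1 * (u $ 1 * v $ 2) + d $ 2 * u $ 2 * v $ 2"
    by (simp add: inner_2 algebra_simps)
  also have "\<dots> = u $ 2 * (d \<bullet> v)" unfolding u by (simp add: inner_2 algebra_simps)
  finally have "v $ 2 = 0" using assms by simp
  with \<open>v $ 1 = 0\<close> show ?thesis by (simp add: vec_eq_iff forall_2)
qed

lemma no_three_collinear_on_line:
  assumes S: "no_three_collinear S" and mem: "p \<in> S" "q \<in> S" "v \<in> S"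
    and d: "d \<bullet> (q - p) \<noteq> 0" and v: "perp (q - p) \<bullet> (v - p) = 0"
  shows "v \<in> {p, q}"
proof (rule ccontr)
  assume v_new: "v \<notin> {p, q}"
  have "p \<noteq> q" using d by auto
  then have "card {q, p, v} = 3" using v_new by auto
  then have nc: "\<not> collinear {q, p, v}" using S mem by (simp add: no_three_collinear_def)
  \<comment> \<open>The only possible factor, read off by applying \<open>d\<close>.\<close>
  define k where "k = d \<bullet> (v - p) / (d \<bullet> (q - p))"
  have "v - p - k *\<^sub>R (q - p) = 0"
  proof (rule inner_perp_nondegenerate[OF d])
    show "d \<bullet> (v - p - k *\<^sub>R (q - p)) = 0"
      using d by (simp add: k_def inner_diff_right[of d "v - p"])
    have "perp (q - p) \<bullet> (q - p) = 0" by (simp add: inner_perp)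
    then show "perp (q - p) \<bullet> (v - p - k *\<^sub>R (q - p)) = 0"
      using v by (simp add: inner_diff_right[of _ "v - p"])
  qed
  then have "v - p = k *\<^sub>R (q - p)" by simp
  then have "collinear {0, q - p, v - p}" by (auto simp: collinear_lemma)
  then show False using nc collinear_3[of q p v] by simp
qed

section \<open>Polygons with prescribed leftmost and rightmost vertices\<close>

context
  fixes S :: "point set" and E :: "point set set" and d :: point
  assumes psl: "plane_straight_line_graph S E"
    and general: "no_three_collinear S"
    and inj: "inj_on (\<lambda>v. d \<bullet> v) S"
begin

definition polygons_between :: "point \<Rightarrow> point \<Rightarrow> point set set set" where
  "polygons_between p q = {C \<in> convex_polygons E. p \<in> \<Union>C \<and> q \<in> \<Union>C \<and> d \<bullet> p < d \<bullet> q \<and>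
     (\<forall>v\<in>\<Union>C. d \<bullet> p \<le> d \<bullet> v \<and> d \<bullet> v \<le> d \<bullet> q)}"

text \<open>Used with \<open>N\<close> and \<open>- N\<close> for the two sides of the line
  \<open>p q\<close>. Including \<open>p\<close> and \<open>q\<close> gives all traces common
  ends.\<close>

definition side :: "point \<Rightarrow> point \<Rightarrow> point \<Rightarrow> point set" where
  "side N p q = {p, q} \<union> {v \<in> S. N \<bullet> p < N \<bullet> v \<and> d \<bullet> p < d \<bullet> v \<and> d \<bullet> v < d \<bullet> q}"

lemma convex_polygon_subset: "C \<in> convex_polygons E \<Longrightarrow> C \<subseteq> E" "C \<in> convex_polygons E \<Longrightarrow> \<Union>C \<subseteq> S"
  using edge(1)[OF psl] by (auto simp: convex_polygons_def is_cycle_in_def)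

lemma compact_hull: "C \<in> convex_polygons E \<Longrightarrow> compact (convex hull (\<Union>C))"
  using convex_polygon_subset(2) finite_vertices[OF psl]
  by (intro compact_convex_hull finite_imp_compact) (rule finite_subset)

lemma finite_convex_polygons: "finite (convex_polygons E)"
proof (rule finite_subset)
  show "convex_polygons E \<subseteq> Pow (Pow S)" using convex_polygon_subset(2) by blast
qed (use finite_vertices[OF psl] in simp)

text \<open>A crossing of gaps would place \<open>j'\<close> above the hull of \<open>C\<close> and
  \<open>k'\<close> above that of \<open>D\<close>; the common vertex between them then falls into a
  gap of the trace of \<open>C\<close>.\<close>

lemma card_side_traces:
  assumes pS: "p \<in> S" "q \<in> S" "d \<bullet> p < d \<bullet> q" "N \<bullet> p = N \<bullet> q"
    and nondeg: "\<And>v. d \<bullet> v = 0 \<Longrightarrow> N \<bullet> v = 0 \<Longrightarrow> v = 0"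
    and up: "d \<bullet> up = 0" "0 < N \<bullet> up"
  shows "real (card ((\<lambda>C. side N p q \<inter> convex hull (\<Union>C)) ` polygons_between p q))
           \<le> path_bound (card (side N p q) - 1)"
proof -
  let ?P = "side N p q" and ?d = "\<lambda>v. d \<bullet> v"
  let ?tr = "\<lambda>C. ?P \<inter> convex hull (\<Union>C)"
  have sub: "?P \<subseteq> S" using pS by (auto simp: side_def)
  have injP: "inj_on ?d ?P" using inj sub by (rule inj_on_subset)
  have finP: "finite ?P" using finite_vertices[OF psl] sub by (rule rev_finite_subset)
  have ends: "p \<in> convex hull (\<Union>C)" "q \<in> convex hull (\<Union>C)" if "C \<in> polygons_between p q" for C
    using that hull_subset[of "\<Union>C" convex] by (auto simp: polygons_between_def)
  \<comment> \<open>The traces are carried to sets of reals by \<open>d\<close>, which is injective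
    on the side and so preserves cardinalities.\<close>
  let ?A = "(`) ?d ` ?tr ` polygons_between p q"
  have "real (card ?A) \<le> path_bound (card (?d ` ?P) - 1)"
  proof (rule card_noncrossing_le)
    show "finite (?d ` ?P)" using finP by simp
    show "?d p \<in> ?d ` ?P" "?d q \<in> ?d ` ?P" "?d p < ?d q" "?d ` ?P \<subseteq> {?d p..?d q}"
      using pS by (auto simp: side_def)
    show "?d p \<in> A \<and> ?d q \<in> A \<and> A \<subseteq> ?d ` ?P" if "A \<in> ?A" for A
      using that ends by (auto simp: side_def)
    show "noncrossing ?A"
      unfolding noncrossing_def
    proof (intro ballI allI impI notI)
      fix A B i j k l
      assume A: "A \<in> ?A" and B: "B \<in> ?A" and gaps: "gap A i k \<and> gap B j l"
        and order: "i < j \<and> j < k \<and> k < l"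
      obtain C where C: "C \<in> polygons_between p q" "A = ?d ` ?tr C" using A by blast
      obtain D where D: "D \<in> polygons_between p q" "B = ?d ` ?tr D" using B by blast
      have mem: "i \<in> A" "k \<in> A" "j \<in> B" "l \<in> B"
        and empty: "A \<inter> {i<..<k} = {}" "B \<inter> {j<..<l} = {}"
        using gaps unfolding gap_def by blast+
      have within: "?d p \<le> ?d v" "?d v \<le> ?d q" if "v \<in> ?P" for v
        using that pS by (auto simp: side_def)
      obtain i' where "i' \<in> ?P" "i = ?d i'" using mem(1) unfolding C(2) by blast
      moreover obtain l' where "l' \<in> ?P" "l = ?d l'" using mem(4) unfolding D(2) by blast
      ultimately have bounds: "?d p \<le> i" "l \<le> ?d q" using within by simp_all
      obtain k' where k: "k' \<in> ?P" "k' \<in> convex hull (\<Union>C)" "k = ?d k'"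
        using mem(2) unfolding C(2) by blast
      obtain j' where j: "j' \<in> ?P" "j' \<in> convex hull (\<Union>D)" "j = ?d j'"
        using mem(3) unfolding D(2) by blast
      have "j \<in> {i<..<k}" "k \<in> {j<..<l}" using order by simp_all
      then have "j \<notin> A" "k \<notin> B" using empty by blast+
      then have notin: "j' \<notin> convex hull (\<Union>C)" "k' \<notin> convex hull (\<Union>D)"
        using j k unfolding C(2) D(2) by blast+
      have strict: "?d p < ?d j'" "?d j' < ?d k'" "?d k' < ?d q" using order bounds j k by auto
      then have above: "N \<bullet> p < N \<bullet> j'" "N \<bullet> p < N \<bullet> k'" using j(1) k(1) by (auto simp: side_def)
      have CE: "C \<in> convex_polygons E" and DE: "D \<in> convex_polygons E"
        using C D by (auto simp: polygons_between_def)
      have "\<exists>v\<in>S \<inter> convex hull (\<Union>C). N \<bullet> p < N \<bullet> v \<and> ?d j' < ?d v \<and> ?d v < ?d k'"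
        by (rule common_vertex_between[OF psl compact_hull[OF CE] convex_convex_hull
            frontier_convex_polygon[OF psl CE] convex_polygon_subset(1)[OF CE]
            compact_hull[OF DE] convex_convex_hull
            frontier_convex_polygon[OF psl DE] convex_polygon_subset(1)[OF DE]
            ends[OF C(1)] ends[OF D(1)] refl pS(4)[symmetric] j(2) notin(1) k(2) notin(2)
            above strict nondeg up inj])
      then obtain v where v: "v \<in> S" "v \<in> convex hull (\<Union>C)" "N \<bullet> p < N \<bullet> v" "j < ?d v" "?d v < k"
        using j k by auto
      then have "v \<in> ?P" using strict j k by (auto simp: side_def)
      then have "?d v \<in> A" using v(2) unfolding C(2) by blast
      moreover have "?d v \<in> {i<..<k}" using v(4,5) order by simp
      ultimately show False using empty(1) by blast
    qed
  qed (auto intro: path_bound_ge_1 path_bound_step)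
  moreover have "card ?A = card (?tr ` polygons_between p q)"
    by (rule card_image, rule inj_on_subset[OF inj_on_image_Pow[OF injP]]) auto
  ultimately show ?thesis using card_image[OF injP] by simp
qed

text \<open>A polygon is determined by its upper and lower traces, so the two path bounds
  multiply.\<close>

lemma card_polygons_between:
  assumes pS: "p \<in> S" "q \<in> S" "d \<bullet> p < d \<bullet> q"
  shows "real (card (polygons_between p q)) \<le> 1.50286 ^ card S"
proof -
  define N where "N = perp (q - p)"
  let ?U = "side N p q" and ?L = "side (- N) p q"
  have dq: "0 < d \<bullet> (q - p)" using pS by (simp add: inner_diff_right)
  have N: "N \<bullet> p = N \<bullet> q" by (simp add: N_def inner_perp algebra_simps)
  have nondeg: "v = 0" if "d \<bullet> v = 0" "N \<bullet> v = 0" for v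
    using inner_perp_nondegenerate[of d "q - p" v] dq that by (simp add: N_def)
  have "d \<bullet> perp d = perp d \<bullet> d" by (rule inner_commute)
  also have "\<dots> = 0" by (simp add: inner_perp)
  finally have d_perp: "d \<bullet> perp d = 0" .
  \<comment> \<open>Moving along \<open>perp d\<close> fixes the \<open>d\<close> coordinate and
    raises \<open>N\<close>, which is the upward direction needed for frontier points.\<close>
  have "N \<bullet> perp d = d \<bullet> (q - p)" unfolding N_def inner_perp_perp by (rule inner_commute)
  with dq d_perp have up: "d \<bullet> perp d = 0" "0 < N \<bullet> perp d" by simp_all
  define a where "a = card ?U - 1"
  define b where "b = card ?L - 1"
  have finS: "finite S" using finite_vertices[OF psl] .
  have fin: "finite ?U" "finite ?L" using finS by (auto simp: side_def)
  have "p \<noteq> q" using pS by auto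
  have Int: "?U \<inter> ?L = {p, q}" by (auto simp: side_def)
  have "card ?U + card ?L = card (?U \<union> ?L) + card {p, q}"
    using card_Un_Int[OF fin] Int by simp
  also have "\<dots> \<le> card S + 2"
    using card_mono[OF finS, of "?U \<union> ?L"] pS \<open>p \<noteq> q\<close> by (auto simp: side_def)
  \<comment> \<open>\<open>p\<close> and \<open>q\<close> are counted on both sides; the
    subtractions in \<open>a\<close> and \<open>b\<close> cancel this surplus of 2.\<close>
  finally have sum: "card ?U + card ?L \<le> card S + 2" .
  have "card {p, q} \<le> card ?U" "card {p, q} \<le> card ?L"
    using fin by (auto intro!: card_mono simp: side_def)
  then have ab: "1 \<le> a" "1 \<le> b" "a + b \<le> card S"
    using sum \<open>p \<noteq> q\<close> by (auto simp: a_def b_def)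
  let ?tU = "\<lambda>C. ?U \<inter> convex hull (\<Union>C)" and ?tL = "\<lambda>C. ?L \<inter> convex hull (\<Union>C)"
  have U: "real (card (?tU ` polygons_between p q)) \<le> path_bound a"
    unfolding a_def by (rule card_side_traces[OF pS N nondeg up])
  have L: "real (card (?tL ` polygons_between p q)) \<le> path_bound b"
    unfolding b_def by (rule card_side_traces[OF pS, of _ "- perp d"]) (use N nondeg up in auto)
  \<comment> \<open>The hull lies in the strip between \<open>p\<close> and \<open>q\<close>, and
    general position leaves no further vertex on their line.\<close>
  have split: "S \<inter> convex hull (\<Union>C) = ?tU C \<union> ?tL C" if C: "C \<in> polygons_between p q" for C
  proof
    have "convex hull (\<Union>C) \<subseteq> {v. d \<bullet> p \<le> d \<bullet> v} \<inter> {v. d \<bullet> v \<le> d \<bullet> q}"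
      by (rule hull_minimal)
        (use C in \<open>auto simp: polygons_between_def intro!: convex_Int convex_halfspace_ge convex_halfspace_le\<close>)
    then have strip: "d \<bullet> p \<le> d \<bullet> v" "d \<bullet> v \<le> d \<bullet> q" if "v \<in> convex hull (\<Union>C)" for v
      using that by auto
    show "S \<inter> convex hull (\<Union>C) \<subseteq> ?tU C \<union> ?tL C"
    proof
      fix v assume v: "v \<in> S \<inter> convex hull (\<Union>C)"
      show "v \<in> ?tU C \<union> ?tL C"
      proof (cases "v \<in> {p, q}")
        case True
        then show ?thesis using v by (auto simp: side_def)
      next
        case False
        have "d \<bullet> v \<noteq> d \<bullet> p" "d \<bullet> v \<noteq> d \<bullet> q" using inj_onD[OF inj] v pS False by auto
        then have "d \<bullet> p < d \<bullet> v" "d \<bullet> v < d \<bullet> q" using strip[of v] v by auto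
        moreover have "N \<bullet> (v - p) \<noteq> 0"
          using no_three_collinear_on_line[OF general pS(1,2), of v d] dq False v by (auto simp: N_def)
        then have "N \<bullet> p < N \<bullet> v \<or> N \<bullet> v < N \<bullet> p" by (auto simp: inner_diff_right)
        ultimately show ?thesis using v by (auto simp: side_def)
      qed
    qed
  qed (use pS in \<open>auto simp: side_def\<close>)
  have finb: "finite (polygons_between p q)"
    by (rule finite_subset[OF _ finite_convex_polygons]) (auto simp: polygons_between_def)
  have "card (polygons_between p q)
      \<le> card ((?tU ` polygons_between p q) \<times> (?tL ` polygons_between p q))"
  proof (rule card_inj_on_le)
    show "inj_on (\<lambda>C. (?tU C, ?tL C)) (polygons_between p q)"
    proof (rule inj_onI)
      fix C D assume CD: "C \<in> polygons_between p q" "D \<in> polygons_between p q"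
        and "(?tU C, ?tL C) = (?tU D, ?tL D)"
      then have "S \<inter> convex hull (\<Union>C) = S \<inter> convex hull (\<Union>D)" by (simp add: split)
      then show "C = D"
        using inj_onD[OF inj_on_vertices_in_hull[OF psl]] CD by (auto simp: polygons_between_def)
    qed
  qed (use finb in auto)
  then have "real (card (polygons_between p q))
      \<le> real (card (?tU ` polygons_between p q)) * real (card (?tL ` polygons_between p q))"
    by (simp add: card_cartesian_product flip: of_nat_mult)
  also have "\<dots> \<le> path_bound a * path_bound b"
    using U L by (intro mult_mono) auto
  also have "\<dots> \<le> path_bound (a + b)" using path_bound_step[OF ab(1,2)] by simp
  also have "\<dots> \<le> 1.50286 ^ (a + b)" using ab by (intro path_bound_le) simp
  also have "\<dots> \<le> 1.50286 ^ card S" using ab by (intro power_increasing) auto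
  finally show ?thesis .
qed

text \<open>\<open>p\<close> and \<open>q\<close> minimize and maximize \<open>d\<close> over the
  vertices; any edge has ends with different \<open>d\<close> values, so the extremes
  differ.\<close>

lemma convex_polygons_cover:
  "convex_polygons E \<subseteq> (\<Union>(p, q)\<in>{(p, q) \<in> S \<times> S. d \<bullet> p < d \<bullet> q}. polygons_between p q)"
proof
  fix C assume C: "C \<in> convex_polygons E"
  have sub: "C \<subseteq> E" "\<Union>C \<subseteq> S" using convex_polygon_subset C by auto
  have fin: "finite (\<Union>C)" using finite_subset[OF sub(2) finite_vertices[OF psl]] .
  obtain vs where vs: "3 \<le> length vs" "C = {{vs ! i, vs ! (Suc i mod length vs)} | i. i < length vs}"
    using C by (auto simp: convex_polygons_def is_cycle_in_def)
  obtain e where e: "e \<in> C" using vs by (cases vs) auto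
  have "card e = 2" using edge(2)[OF psl] e sub by blast
  then obtain x y where xy: "e = {x, y}" "x \<noteq> y" by (meson card_2_iff)
  have xyC: "x \<in> \<Union>C" "y \<in> \<Union>C" using e xy by auto
  have dxy: "d \<bullet> x \<noteq> d \<bullet> y" using inj_onD[OF inj] xyC xy(2) sub(2) by blast
  let ?X = "(\<lambda>v. d \<bullet> v) ` \<Union>C"
  have X: "finite ?X" "?X \<noteq> {}" using fin xyC by auto
  obtain p where p: "p \<in> \<Union>C" "d \<bullet> p = Min ?X" using Min_in[OF X] by (metis imageE)
  obtain q where q: "q \<in> \<Union>C" "d \<bullet> q = Max ?X" using Max_in[OF X] by (metis imageE)
  have bounds: "d \<bullet> p \<le> d \<bullet> v" "d \<bullet> v \<le> d \<bullet> q" if "v \<in> \<Union>C" for v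
    using that X by (auto simp: p q)
  have "d \<bullet> p < d \<bullet> q" using bounds[OF xyC(1)] bounds[OF xyC(2)] dxy by linarith
  then have "C \<in> polygons_between p q" using C p q bounds by (auto simp: polygons_between_def)
  then show "C \<in> (\<Union>(p, q)\<in>{(p, q) \<in> S \<times> S. d \<bullet> p < d \<bullet> q}. polygons_between p q)"
    using p q sub \<open>d \<bullet> p < d \<bullet> q\<close> by blast
qed

lemma card_convex_polygons: "real (card (convex_polygons E)) \<le> real (card S) ^ 2 * 1.50286 ^ card S"
proof -
  let ?I = "{(p, q) \<in> S \<times> S. d \<bullet> p < d \<bullet> q}"
  have finS: "finite S" using finite_vertices[OF psl] .
  have finI: "finite ?I" by (rule finite_subset[of _ "S \<times> S"]) (use finS in auto)
  have "card (convex_polygons E) \<le> card (\<Union>(p, q)\<in>?I. polygons_between p q)"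
    by (rule card_mono[OF _ convex_polygons_cover], rule finite_subset[OF _ finite_convex_polygons])
      (auto simp: polygons_between_def)
  also have "\<dots> \<le> (\<Sum>(p, q)\<in>?I. card (polygons_between p q))"
    using card_UN_le[OF finI, of "\<lambda>(p, q). polygons_between p q"] by (simp add: case_prod_beta)
  finally have "real (card (convex_polygons E)) \<le> real (\<Sum>(p, q)\<in>?I. card (polygons_between p q))"
    by (rule of_nat_mono)
  also have "\<dots> = (\<Sum>(p, q)\<in>?I. real (card (polygons_between p q)))" by (simp add: case_prod_beta)
  also have "\<dots> \<le> (\<Sum>(p, q)\<in>?I. 1.50286 ^ card S)"
    by (rule sum_mono) (use card_polygons_between in auto)
  also have "\<dots> = real (card ?I) * 1.50286 ^ card S" by (simp add: case_prod_beta)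
  also have "\<dots> \<le> real (card S) ^ 2 * 1.50286 ^ card S"
  proof -
    have "card ?I \<le> card (S \<times> S)" by (rule card_mono) (use finS in auto)
    then have "card ?I \<le> card S ^ 2" by (simp add: card_cartesian_product power2_eq_square)
    then have "real (card ?I) \<le> real (card S) ^ 2" by (simp flip: of_nat_power)
    then show ?thesis by (intro mult_right_mono) auto
  qed
  finally show ?thesis .
qed

end

section \<open>From the uniform bound to the asymptotic estimate\<close>

lemma max_convex_polygons_le: "real (max_convex_polygons n) \<le> real n ^ 2 * 1.50286 ^ n"
proof -
  define X where "X = {card (convex_polygons E) | S E.
       finite S \<and> card S = n \<and> no_three_collinear S \<and> geometric_triangulation S E}"
  let ?b = "real n ^ 2 * 1.50286 ^ n"
  have "real k \<le> ?b" if k_in: "k \<in> X" for k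
  proof -
    obtain S E where k: "k = card (convex_polygons E)" and S: "finite S" "card S = n"
      "no_three_collinear S" "plane_straight_line_graph S E"
      using k_in by (auto simp: X_def geometric_triangulation_def)
    obtain d where "inj_on (\<lambda>v. d \<bullet> v) S" using exists_injective_direction[OF S(1)] by blast
    from card_convex_polygons[OF S(4,3) this] show ?thesis using S k by simp
  qed
  \<comment> \<open>The floor turns the real bound into a natural one, as \<open>Sup\<close> is
    taken over naturals; the supremum of the empty set is 0.\<close>
  then have "k \<le> nat \<lfloor>?b\<rfloor>" if "k \<in> X" for k using that by (simp add: le_nat_floor)
  then have "Sup X \<le> nat \<lfloor>?b\<rfloor>"
    by (cases "X = {}") (simp add: Sup_nat_def, rule cSup_least)
  then have "real (Sup X) \<le> real (nat \<lfloor>?b\<rfloor>)" by (rule of_nat_mono)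
  also have "\<dots> \<le> ?b" by (rule of_nat_floor) simp
  finally show ?thesis by (simp add: max_convex_polygons_def X_def)
qed

theorem theorem1:
  "(\<lambda>n. real (max_convex_polygons n)) \<in> O(\<lambda>n. 1.5029 ^ n)"
proof -
  have "(\<lambda>n. real (max_convex_polygons n)) \<in> O(\<lambda>n. real n ^ 2 * 1.50286 ^ n)"
    by (rule bigoI[where c = 1]) (use max_convex_polygons_le in auto)
  also have "(\<lambda>n. real n ^ 2 * 1.50286 ^ n) \<in> O(\<lambda>n. 1.5029 ^ n)"
  proof (rule bigoI_tendsto)
    \<comment> \<open>With the square root, squaring the known limit of \<open>n * y ^ n\<close>
      yields exactly \<open>n\<^sup>2\<close> times the powers of the ratio of the bases, so the
      larger base absorbs the polynomial factor.\<close>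
    define y :: real where "y = sqrt (1.50286 / 1.5029)"
    have "(\<lambda>n. real n * y ^ n) \<longlonglongrightarrow> 0"
      using powser_times_n_limit_0[of y] by (simp add: y_def)
    from tendsto_power[OF this, of 2] have "(\<lambda>n. (real n * y ^ n)\<^sup>2) \<longlonglongrightarrow> 0" by simp
    moreover have "(real n * y ^ n)\<^sup>2 = real n ^ 2 * 1.50286 ^ n / 1.5029 ^ n" for n
    proof -
      have "(real n * y ^ n)\<^sup>2 = real n ^ 2 * (y\<^sup>2) ^ n"
        by (simp add: power_mult_distrib mult.commute flip: power_mult)
      also have "y\<^sup>2 = 1.50286 / 1.5029" by (simp add: y_def)
      finally show ?thesis by (simp only: power_divide times_divide_eq_right)
    qed
    ultimately show "(\<lambda>n. real n ^ 2 * 1.50286 ^ n / 1.5029 ^ n) \<longlonglongrightarrow> 0" by simp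
  qed simp
  finally show ?thesis .
qed

end
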